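(* Let $l\in\mathbb N$, let $C,D$ be circles in the plane $\mathbb R^2$, let $c_1,\ldots,c_l$ be pairwise distinct points from the interior of $C$, and let $d_1,\ldots,d_l$ be pairwise distinct points from the interior of $D$. Put $S=C\cup\{c_1,\ldots,c_l\}$ and $R=D\cup\{d_1,\ldots,d_l\}$. Then $S$ and $R$ are betweenness isomorphic if and only if there exists a betweenness isomorphism $\tilde f$ of $\operatorname{c-hull}_S(\{c_1,\ldots,c_l\})$ and $\operatorname{c-hull}_R(\{d_1,\ldots,d_l\})$ with the following property: letting $\sigma$ be the permutation of $\{1,\ldots,l\}$ given by $\tilde f(c_i)=d_{\sigma(i)}$ for every $i\in\{1,\ldots,l\}$, there exists a bijection $h\colon\mathcal O_C\to\mathcal O_D$ such that, for every $\mathbf O\in\mathcal O_C$, there are $x_{\mathbf O}\in\mathbf O$ and $y_{\mathbf O}\in h(\mathbf O)$ with $$\mathbf S(y_{\mathbf O})=\{\psi_\sigma(g):g\in\mathbf S(x_{\mathbf O})\}.$$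
   Context: For $a,b\in\mathbb R^2$, $[a,b]$ is the closed segment and $(a,b)=[a,b]\setminus\{a,b\}$ the open segment (empty if $a=b$). A betweenness isomorphism of sets $S,R\subset\mathbb R^2$ is a bijection $f\colon S\to R$ such that for all $a,b,c\in S$: $c\in(a,b)\iff f(c)\in(f(a),f(b))$; $S,R$ are betweenness isomorphic if such a map exists. For $A\subset S\subset\mathbb R^2$, $A$ is collinearly closed in $S$ if $c\in A$ whenever $c\in S$ and there exist distinct $a,b\in A\setminus\{c\}$ such that $a,b,c$ are collinear. $\operatorname{c-hull}_S(A)$ is the smallest set that is collinearly closed in $S$ and contains $A$. (Any betweenness isomorphism $\tilde f$ of $\operatorname{c-hull}_S(\{c_1,\ldots,c_l\})$ and $\operatorname{c-hull}_R(\{d_1,\ldots,d_l\})$ maps $\{c_1,\ldots,c_l\}$ bijectively onto $\{d_1,\ldots,d_l\}$, so $\sigma$ in the claim is well defined.) The group $G_l$: its elements are all finite sequences $(i_1,\ldots,i_n)$ ($n\ge0$) of elements of $\{1,\ldots,l\}$ that are irreducible, i.e. $i_k\ne i_{k+1}$ for all $1\le k\le n-1$ (the empty sequence $\emptyset$ is included). The product is concatenation followed by reduction (repeatedly deleting pairs of equal adjacent entries until the sequence is irreducible); the identity is $\emptyset$ and the inverse of $(i_1,\ldots,i_n)$ is $(i_n,\ldots,i_1)$. For a circle $C$ and a point $X$ in its interior, the reversion $P_X\colon C\to C$ sends $c\in C$ to the unique point $P_X(c)\in C$ with $X\in(c,P_X(c))$. With $R_i=P_{c_i}$, $G_l$ acts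 on $C$ from the right by $c\cdot\emptyset=c$, $c\cdot(i_1,\ldots,i_n)=(R_{i_n}\circ\cdots\circ R_{i_1})(c)$. Likewise $G_l$ acts on $D$ from the right using the reversions of $D$ through $d_1,\ldots,d_l$. For a point $c$ of $C$ (or of $D$), $\mathbf O(c)=\{c\cdot g:g\in G_l\}$ is its orbit and $\mathbf S(c)=\{g\in G_l:c\cdot g=c\}$ its stabilizer. $\mathcal O_C=\{\mathbf O(c):c\in C\setminus\operatorname{c-hull}_S(\{c_1,\ldots,c_l\})\}$ and $\mathcal O_D=\{\mathbf O(d):d\in D\setminus\operatorname{c-hull}_R(\{d_1,\ldots,d_l\})\}$. For a permutation $\sigma$ of $\{1,\ldots,l\}$, $\psi_\sigma$ is the automorphism of $G_l$ with $\psi_\sigma(\emptyset)=\emptyset$ and $\psi_\sigma(i_1,\ldots,i_n)=(\sigma(i_1),\ldots,\sigma(i_n))$. *)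

theory Defs
  imports "HOL-Analysis.Analysis" "HOL-Algebra.Group"
begin

definition betweenness_iso :: "(real^2 \<Rightarrow> real^2) \<Rightarrow> (real^2) set \<Rightarrow> (real^2) set \<Rightarrow> bool" where
  "betweenness_iso f S R \<longleftrightarrow> bij_betw f S R \<and>
     (\<forall>a\<in>S. \<forall>b\<in>S. \<forall>c\<in>S. c \<in> open_segment a b \<longleftrightarrow> f c \<in> open_segment (f a) (f b))"

definition betweenness_isomorphic :: "(real^2) set \<Rightarrow> (real^2) set \<Rightarrow> bool" where
  "betweenness_isomorphic S R \<longleftrightarrow> (\<exists>f. betweenness_iso f S R)"

definition collinearly_closed :: "(real^2) set \<Rightarrow> (real^2) set \<Rightarrow> bool" where
  "collinearly_closed S A \<longleftrightarrow> A \<subseteq> S \<and>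
     (\<forall>c\<in>S. (\<exists>a\<in>A - {c}. \<exists>b\<in>A - {c}. a \<noteq> b \<and> collinear {a, b, c}) \<longrightarrow> c \<in> A)"

definition c_hull :: "(real^2) set \<Rightarrow> (real^2) set \<Rightarrow> (real^2) set" where
  "c_hull S A = collinearly_closed S hull A"

text \<open>For \<open>A \<subseteq> S\<close> the intersection defining \<^const>\<open>c_hull\<close> is itself collinearly closed,
  so it is the smallest collinearly closed set containing \<open>A\<close>.\<close>

lemma collinearly_closed_c_hull:
  assumes "A \<subseteq> S"
  shows "collinearly_closed S (c_hull S A)" "A \<subseteq> c_hull S A"
    "\<And>B. collinearly_closed S B \<Longrightarrow> A \<subseteq> B \<Longrightarrow> c_hull S A \<subseteq> B"
proof -
  have S: "collinearly_closed S S"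
    by (auto simp: collinearly_closed_def)
  show "collinearly_closed S (c_hull S A)"
    unfolding collinearly_closed_def
  proof (intro conjI ballI impI)
    show "c_hull S A \<subseteq> S"
      unfolding c_hull_def using assms S by (intro hull_minimal) auto
    fix c assume c: "c \<in> S"
      "\<exists>a\<in>c_hull S A - {c}. \<exists>b\<in>c_hull S A - {c}. a \<noteq> b \<and> collinear {a, b, c}"
    show "c \<in> c_hull S A"
      unfolding c_hull_def hull_def
    proof (rule InterI, clarify)
      fix B assume B: "collinearly_closed S B" "A \<subseteq> B"
      have "c_hull S A \<subseteq> B"
        unfolding c_hull_def using B by (intro hull_minimal) auto
      with c B(1) show "c \<in> B"
        unfolding collinearly_closed_def by blast
    qed
  qed
qed (auto simp: c_hull_def hull_subset hull_minimal)

text \<open>\<open>reduce\<close> deletes pairs of equal adjacent entries, working from the right end. By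
  \<open>reduce_delete_pair\<close> and \<open>reduce_irreducible\<close> below, every order of deletions ends in the
  same irreducible sequence.\<close>

fun reduce_Cons :: "nat \<Rightarrow> nat list \<Rightarrow> nat list" where
  "reduce_Cons i [] = [i]"
| "reduce_Cons i (j # js) = (if i = j then js else i # j # js)"

fun reduce :: "nat list \<Rightarrow> nat list" where
  "reduce [] = []"
| "reduce (i # is) = reduce_Cons i (reduce is)"

definition seq_group :: "nat \<Rightarrow> nat list monoid" where
  "seq_group l =
     \<lparr>carrier = {is. set is \<subseteq> {1..l} \<and> distinct_adj is},
      mult = (\<lambda>is js. reduce (is @ js)),
      one = []\<rparr>"

lemma distinct_adj_reduce: "distinct_adj (reduce is)"
proof (induction "is")
  case (Cons i "is")
  then show ?case
    by (cases "reduce is") (auto simp: distinct_adj_Cons)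
qed simp

lemma reduce_irreducible: "distinct_adj is \<Longrightarrow> reduce is = is"
proof (induction "is")
  case (Cons i "is")
  then show ?case
    by (cases "is") (auto simp: distinct_adj_Cons)
qed simp

lemma reduce_Cons_Cons: "distinct_adj is \<Longrightarrow> reduce_Cons i (reduce_Cons i is) = is"
  by (cases "is"; cases "tl is") auto

lemma reduce_delete_pair: "reduce (is @ [i, i] @ js) = reduce (is @ js)"
  by (induction "is") (auto simp: reduce_Cons_Cons distinct_adj_reduce)

lemma reduce_append_reduce: "reduce (is @ reduce js) = reduce (is @ js)"
  by (induction "is") (auto simp: reduce_irreducible distinct_adj_reduce)

lemma reduce_reduce_append: "reduce (reduce is @ js) = reduce (is @ js)"
proof (induction "is")
  case (Cons i "is")
  show ?case
  proof (cases "reduce is")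
    case Nil
    then show ?thesis using Cons by simp
  next
    case (Cons k ks)
    then show ?thesis
      using Cons.IH reduce_Cons_Cons[OF distinct_adj_reduce, of k "ks @ js"] by auto
  qed
qed simp

lemma set_reduce: "set (reduce is) \<subseteq> set is"
proof (induction "is")
  case (Cons i "is")
  then show ?case
    by (cases "reduce is") auto
qed simp

lemma reduce_rev_append: "reduce (rev is @ is) = []"
proof (induction "is")
  case (Cons i "is")
  then show ?case
    using reduce_delete_pair[of "rev is" i "is"] by simp
qed simp

lemma group_seq_group: "group (seq_group l)"
proof (rule groupI)
  fix x y assume "x \<in> carrier (seq_group l)" "y \<in> carrier (seq_group l)"
  then show "x \<otimes>\<^bsub>seq_group l\<^esub> y \<in> carrier (seq_group l)"
    using set_reduce[of "x @ y"] distinct_adj_reduce by (force simp: seq_group_def)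
next
  fix x assume x: "x \<in> carrier (seq_group l)"
  then have "rev x \<in> carrier (seq_group l)"
    by (simp add: seq_group_def)
  moreover have "rev x \<otimes>\<^bsub>seq_group l\<^esub> x = \<one>\<^bsub>seq_group l\<^esub>"
    by (simp add: seq_group_def reduce_rev_append)
  ultimately show "\<exists>y\<in>carrier (seq_group l). y \<otimes>\<^bsub>seq_group l\<^esub> x = \<one>\<^bsub>seq_group l\<^esub>"
    by blast
qed (auto simp: seq_group_def reduce_reduce_append reduce_append_reduce reduce_irreducible)

text \<open>Meaningful for a circle \<open>C\<close>, a point \<open>X\<close> inside \<open>C\<close> and \<open>c \<in> C\<close>.\<close>

definition reversion :: "(real^2) set \<Rightarrow> real^2 \<Rightarrow> real^2 \<Rightarrow> real^2" where
  "reversion C X c = (THE c'. c' \<in> C \<and> X \<in> open_segment c c')"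

text \<open>\<^const>\<open>fold\<close> applies the reversion belonging to the first entry first.\<close>

definition act :: "(real^2) set \<Rightarrow> (nat \<Rightarrow> real^2) \<Rightarrow> real^2 \<Rightarrow> nat list \<Rightarrow> real^2" where
  "act C p x g = fold (\<lambda>i. reversion C (p i)) g x"

definition orbit_of :: "nat \<Rightarrow> (real^2) set \<Rightarrow> (nat \<Rightarrow> real^2) \<Rightarrow> real^2 \<Rightarrow> (real^2) set" where
  "orbit_of l C p x = {act C p x g | g. g \<in> carrier (seq_group l)}"

definition stabilizer_of :: "nat \<Rightarrow> (real^2) set \<Rightarrow> (nat \<Rightarrow> real^2) \<Rightarrow> real^2 \<Rightarrow> nat list set" where
  "stabilizer_of l C p x = {g \<in> carrier (seq_group l). act C p x g = x}"

text \<open>The orbits of the points of the circle \<open>C\<close> outside the hull of \<open>{p 1, \<dots>, p l}\<close>, taken in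
  \<open>C \<union> {p 1, \<dots>, p l}\<close>.\<close>

definition outer_orbits :: "nat \<Rightarrow> (real^2) set \<Rightarrow> (nat \<Rightarrow> real^2) \<Rightarrow> (real^2) set set" where
  "outer_orbits l C p =
     {orbit_of l C p x | x. x \<in> C - c_hull (C \<union> p ` {1..l}) (p ` {1..l})}"

definition psi :: "(nat \<Rightarrow> nat) \<Rightarrow> nat list \<Rightarrow> nat list" where
  "psi \<sigma> g = map \<sigma> g"

end

theory Submission
  imports Defs
begin

text \<open>Inside \<open>S\<close> the only points lying between two others are the interior points \<open>c\<^sub>i\<close>, so a
  betweenness isomorphism maps circle to circle and marked points to marked points, intertwines the
  reversions, and therefore carries orbits to orbits with the stabilizers twisted by \<open>\<psi>\<^sub>\<sigma>\<close>.
  Conversely, a line through a marked point and a circle point outside the hull meets \<open>S\<close> in no other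
  hull point, so betweenness involving such a point is entirely described by the reversions. Hence
  extending \<open>f\<close> by \<open>x\<^sub>O \<cdot> g \<mapsto> y\<^sub>O \<cdot> \<psi>\<^sub>\<sigma>(g)\<close> on every outer orbit gives a
  betweenness isomorphism; the stabilizer condition says exactly that this is well defined and
  injective.\<close>

section \<open>Betweenness isomorphisms and hulls\<close>

text \<open>This makes collinear closedness a betweenness notion, so that betweenness isomorphisms
  respect it. Distinctness matters because open segments omit their endpoints.\<close>

lemma collinear_iff_open_segments:
  fixes a b c :: "'a::euclidean_space"
  assumes "a \<noteq> b" "a \<noteq> c" "b \<noteq> c"
  shows "collinear {a, b, c} \<longleftrightarrow>
    a \<in> open_segment b c \<or> b \<in> open_segment c a \<or> c \<in> open_segment a b"
  using assms by (auto simp: collinear_between_cases between_mem_segment open_segment_def)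

lemma betweenness_iso_collinear:
  assumes f: "betweenness_iso f S R" and S: "a \<in> S" "b \<in> S" "c \<in> S"
    and distinct: "a \<noteq> b" "a \<noteq> c" "b \<noteq> c"
  shows "collinear {f a, f b, f c} \<longleftrightarrow> collinear {a, b, c}"
proof -
  have inj: "inj_on f S"
    using f by (auto simp: betweenness_iso_def bij_betw_def)
  then have "f a \<noteq> f b" "f a \<noteq> f c" "f b \<noteq> f c"
    using S distinct by (auto dest: inj_onD)
  then show ?thesis
    using f S distinct by (simp add: collinear_iff_open_segments betweenness_iso_def)
qed

lemma betweenness_iso_inv_into:
  assumes "betweenness_iso f S R"
  shows "betweenness_iso (inv_into S f) R S"
proof -
  have bij: "bij_betw f S R"
    using assms by (simp add: betweenness_iso_def)
  have "inv_into S f y \<in> S" "f (inv_into S f y) = y" if "y \<in> R" for y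
    using that bij by (auto simp: bij_betw_def inv_into_into f_inv_into_f)
  then show ?thesis
    using assms bij by (auto simp: betweenness_iso_def bij_betw_inv_into)
qed

lemma collinearly_closed_image:
  assumes f: "betweenness_iso f S R" and A: "collinearly_closed S A"
  shows "collinearly_closed R (f ` A)"
  unfolding collinearly_closed_def
proof (intro conjI ballI impI)
  have AS: "A \<subseteq> S" and fS: "f ` S = R"
    using f A by (auto simp: betweenness_iso_def collinearly_closed_def bij_betw_def)
  then show "f ` A \<subseteq> R"
    by blast
  fix y
  assume "y \<in> R" and
    *: "\<exists>a\<in>f ` A - {y}. \<exists>b\<in>f ` A - {y}. a \<noteq> b \<and> collinear {a, b, y}"
  from \<open>y \<in> R\<close> fS obtain x where x: "x \<in> S" "y = f x"
    by blast
  from * x obtain a b where ab: "a \<in> A" "b \<in> A" "f a \<noteq> f x" "f b \<noteq> f x" "f a \<noteq> f b"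
    "collinear {f a, f b, f x}"
    by auto
  then have "collinear {a, b, x}"
    using betweenness_iso_collinear[OF f, of a b x] AS x by auto
  moreover have "a \<in> A - {x}" "b \<in> A - {x}" "a \<noteq> b"
    using ab by auto
  ultimately have "x \<in> A"
    using A x(1) unfolding collinearly_closed_def by blast
  then show "y \<in> f ` A"
    using x by blast
qed

text \<open>Both inclusions come from minimality of hulls: images of closed sets are closed, and
  this applies to \<open>f\<close> as well as to its inverse.\<close>

lemma c_hull_image:
  assumes f: "betweenness_iso f S R" and A: "A \<subseteq> S"
  shows "f ` c_hull S A = c_hull R (f ` A)"
proof -
  let ?g = "inv_into S f"
  have inj: "inj_on f S" and fS: "f ` S = R"
    using f by (auto simp: betweenness_iso_def bij_betw_def)
  have fA: "f ` A \<subseteq> R"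
    using A fS by blast
  have "f ` A \<subseteq> f ` c_hull S A"
    using collinearly_closed_c_hull(2)[OF A] by blast
  then have "c_hull R (f ` A) \<subseteq> f ` c_hull S A"
    by (intro collinearly_closed_c_hull(3)[OF fA] collinearly_closed_image[OF f]
        collinearly_closed_c_hull(1)[OF A])
  moreover have "A \<subseteq> ?g ` c_hull R (f ` A)"
  proof -
    have "?g ` f ` A = A"
      using inj A by (rule inv_into_image_cancel)
    then show ?thesis
      using collinearly_closed_c_hull(2)[OF fA] by blast
  qed
  then have "c_hull S A \<subseteq> ?g ` c_hull R (f ` A)"
    by (intro collinearly_closed_c_hull(3)[OF A]
        collinearly_closed_image[OF betweenness_iso_inv_into[OF f]]
        collinearly_closed_c_hull(1)[OF fA])
  then have "f ` c_hull S A \<subseteq> f ` ?g ` c_hull R (f ` A)"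
    by blast
  moreover have "f ` ?g ` c_hull R (f ` A) = c_hull R (f ` A)"
    using fS collinearly_closed_c_hull(1)[OF fA]
    by (intro image_inv_into_cancel) (auto simp: collinearly_closed_def)
  ultimately show ?thesis
    by blast
qed

section \<open>Reversions\<close>

text \<open>Since \<open>x\<close> is on the sphere, the squared norm equation is a quadratic in
  \<open>t\<close> without constant term. It splits into \<open>t = 0\<close>, the point
  \<open>x\<close> itself, and a linear equation for the other intersection.\<close>

lemma circle_line_second_point:
  fixes x q z :: "'a::real_inner"
  assumes "x \<in> sphere z r"
  shows "x + t *\<^sub>R (q - x) \<in> sphere z r \<longleftrightarrow>
    t = 0 \<or> t * ((q - x) \<bullet> (q - x)) = - 2 * ((x - z) \<bullet> (q - x))"
proof -
  have r: "0 \<le> r" and xr: "(x - z) \<bullet> (x - z) = r\<^sup>2"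
    using assms by (auto simp: dist_norm norm_minus_commute power2_norm_eq_inner[symmetric])
  have "x + t *\<^sub>R (q - x) \<in> sphere z r \<longleftrightarrow> (norm ((x - z) + t *\<^sub>R (q - x)))\<^sup>2 = r\<^sup>2"
    using r by (simp add: dist_norm norm_minus_commute[of z] add_diff_eq diff_add_eq)
  also have "(norm ((x - z) + t *\<^sub>R (q - x)))\<^sup>2 =
      r\<^sup>2 + t * (2 * ((x - z) \<bullet> (q - x)) + t * ((q - x) \<bullet> (q - x)))"
    unfolding power2_norm_eq_inner inner_add_left inner_add_right inner_scaleR_left
      inner_scaleR_right xr inner_commute[of "q - x" "x - z"]
    by (simp add: algebra_simps)
  finally show ?thesis
    by auto
qed

lemma mem_open_segment_ray:
  fixes x y q :: "'a::real_vector"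
  assumes "q \<in> open_segment x y"
  obtains t where "t > 1" "y = x + t *\<^sub>R (q - x)"
proof -
  obtain u where u: "0 < u" "u < 1" "q = (1 - u) *\<^sub>R x + u *\<^sub>R y"
    using assms by (auto simp: in_segment)
  then have "q - x = u *\<^sub>R (y - x)"
    by (simp add: algebra_simps)
  then have "y = x + (1 / u) *\<^sub>R (q - x)"
    using u by simp
  then show ?thesis
    using u by (intro that[of "1 / u"]) auto
qed

text \<open>On the line where \<open>x\<close> has parameter 0 and \<open>q\<close> has parameter 1,
  the second intersection has parameter \<open>?m / ?n\<close>. It exceeds 1 because
  \<open>q\<close> is interior, so \<open>q\<close> lies strictly between. Any competitor has
  parameter above 1 too and solves the same linear equation.\<close>

lemma ex1_reversion:
  fixes x q z :: "'a::real_inner"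
  assumes x: "x \<in> sphere z r" and q: "q \<in> ball z r"
  shows "\<exists>!y. y \<in> sphere z r \<and> q \<in> open_segment x y"
proof -
  let ?n = "(q - x) \<bullet> (q - x)" and ?m = "- 2 * ((x - z) \<bullet> (q - x))"
  have "x \<noteq> q"
    using x q by auto
  then have n: "?n > 0"
    by simp
  \<comment> \<open>Expanding the squared distance from \<open>z\<close> to \<open>q\<close> around
    \<open>x\<close> turns interiority of \<open>q\<close> into \<open>?n < ?m\<close>.\<close>
  have "(norm (q - z))\<^sup>2 < (norm (x - z))\<^sup>2"
    using x q by (simp add: dist_norm norm_minus_commute power_strict_mono)
  moreover have "(norm (q - z))\<^sup>2 = (norm (x - z))\<^sup>2 - ?m + ?n"
    unfolding power2_norm_eq_inner by (simp add: inner_diff_left inner_diff_right inner_commute)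
  ultimately have mn: "?n < ?m"
    by linarith
  define t where "t = ?m / ?n"
  have t: "t > 1" "t * ?n = ?m"
    using n mn by (simp_all only: t_def less_divide_eq_1_pos nonzero_eq_divide_eq) auto
  define y where "y = x + t *\<^sub>R (q - x)"
  have "y \<in> sphere z r"
    unfolding y_def circle_line_second_point[OF x] using t by simp
  moreover have "q \<in> open_segment x y"
  proof -
    have "x \<noteq> y"
      using t \<open>x \<noteq> q\<close> by (simp add: y_def)
    moreover have "q = (1 - 1 / t) *\<^sub>R x + (1 / t) *\<^sub>R y"
      using t by (simp add: y_def algebra_simps)
    ultimately show ?thesis
      using t unfolding in_segment by (intro conjI exI[of _ "1 / t"]) auto
  qed
  moreover have "y' = y" if y': "y' \<in> sphere z r" "q \<in> open_segment x y'" for y'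
  proof -
    obtain t' where t': "t' > 1" "y' = x + t' *\<^sub>R (q - x)"
      using mem_open_segment_ray[OF y'(2)] by blast
    have "t' * ?n = ?m"
      using y'(1) t' unfolding t'(2) circle_line_second_point[OF x] by simp
    then have "t' = t"
      using t(2) n by (metis less_irrefl mult_right_cancel)
    then show ?thesis
      by (simp add: t' y_def)
  qed
  ultimately show ?thesis
    by blast
qed

text \<open>Reduction only tests entries for equality, and an injective relabelling preserves and
  reflects equality.\<close>

lemma reduce_map:
  assumes "inj \<sigma>"
  shows "reduce (map \<sigma> g) = map \<sigma> (reduce g)"
proof (induction g)
  case (Cons i g)
  then show ?case
    using assms by (cases "reduce g") (auto dest: injD)
qed simp

text \<open>Surjectivity of the relabelling on words, used to pull words acting on \<open>D\<close>
  back to words acting on \<open>C\<close>.\<close>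

lemma permutes_word_preimage:
  assumes "\<sigma> permutes A" "set k \<subseteq> A"
  obtains g where "k = map \<sigma> g" "set g \<subseteq> A"
proof -
  have "k \<in> map \<sigma> ` lists A"
    using assms by (simp add: lists_image[symmetric] permutes_image in_lists_conv_set subset_iff)
  then show ?thesis
    using that by auto
qed

lemma act_append: "act C p x (g @ h) = act C p (act C p x g) h"
  by (simp add: act_def)

section \<open>One circle with marked interior points\<close>

locale circle_with_points =
  fixes z :: "real^2" and r :: real and l :: nat and p :: "nat \<Rightarrow> real^2"
  assumes inj_p: "inj_on p {1..l}"
    and p_in_ball: "i \<in> {1..l} \<Longrightarrow> p i \<in> ball z r"
begin

abbreviation "circle \<equiv> sphere z r"
abbreviation "marked \<equiv> p ` {1..l}"
abbreviation "points \<equiv> circle \<union> marked"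
abbreviation "inner_hull \<equiv> c_hull points marked"
abbreviation "reversal i \<equiv> reversion circle (p i)"
abbreviation "act_on \<equiv> act circle p"
abbreviation "orbit \<equiv> orbit_of l circle p"
abbreviation "stab \<equiv> stabilizer_of l circle p"

lemma marked_notin_circle: "q \<in> marked \<Longrightarrow> q \<notin> circle"
  using p_in_ball by fastforce

lemma
  assumes "x \<in> circle" "i \<in> {1..l}"
  shows reversal_in_circle: "reversal i x \<in> circle"
    and reversal_between: "p i \<in> open_segment x (reversal i x)"
  using theI'[OF ex1_reversion[OF assms(1) p_in_ball[OF assms(2)]]]
  unfolding reversion_def by auto

lemma reversal_eqI:
  assumes "x \<in> circle" "i \<in> {1..l}" "y \<in> circle" "p i \<in> open_segment x y"
  shows "reversal i x = y"
  using ex1_reversion[OF assms(1) p_in_ball[OF assms(2)]] reversal_in_circle[OF assms(1,2)]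
    reversal_between[OF assms(1,2)] assms(3,4) by blast

lemma reversal_reversal:
  assumes "x \<in> circle" "i \<in> {1..l}"
  shows "reversal i (reversal i x) = x"
  using reversal_in_circle[OF assms] reversal_between[OF assms] assms
  by (intro reversal_eqI) (auto simp: open_segment_commute)

text \<open>Strict convexity of the disc: inside an open segment the distance to \<open>z\<close> is
  strictly below the larger of its values at the endpoints, which are at most
  \<open>r\<close>.\<close>

lemma circle_extreme:
  assumes "a \<in> points" "b \<in> points" "q \<in> open_segment a b"
  shows "q \<notin> circle"
proof -
  have "dist z a \<le> r" "dist z b \<le> r"
    using assms(1,2) p_in_ball by fastforce+
  then show ?thesis
    using dist_decreases_open_segment[of q a b] assms(3) by (force dest: spec[of _ z])
qed

text \<open>Singles out the marked points by betweenness alone, so a betweenness isomorphism has to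
  respect them.\<close>

lemma marked_iff_between:
  assumes "q \<in> points"
  shows "q \<in> marked \<longleftrightarrow> (\<exists>a\<in>points. \<exists>b\<in>points. q \<in> open_segment a b)"
proof
  assume "q \<in> marked"
  then obtain i where i: "i \<in> {1..l}" "q = p i"
    by blast
  \<comment> \<open>A marked point in the ball forces a positive radius, hence there is a circle
    point \<open>x\<close>; then \<open>q\<close> lies between \<open>x\<close> and its
    reversion.\<close>
  then have "0 < r"
    using p_in_ball[OF i(1)] by (metis dist_not_less_zero mem_ball not_less_iff_gr_or_eq order.strict_trans)
  then obtain x where "x \<in> circle"
    by (metis all_not_in_conv order_less_imp_not_less sphere_eq_empty)
  then show "\<exists>a\<in>points. \<exists>b\<in>points. q \<in> open_segment a b"
    using reversal_in_circle reversal_between i by blast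
qed (use assms circle_extreme in blast)

subsection \<open>Outer points\<close>

lemma marked_subset_hull: "marked \<subseteq> inner_hull"
  by (rule collinearly_closed_c_hull) simp

lemma hull_subset_points: "inner_hull \<subseteq> points"
  using collinearly_closed_c_hull(1)[of marked points] by (simp add: collinearly_closed_def)

lemma points_diff_hull: "points - inner_hull = circle - inner_hull"
  using marked_subset_hull by blast

text \<open>\<open>a\<close> is on the line through the two distinct hull points \<open>q\<close>
  and \<open>b\<close>. Used contrapositively: a segment from an outer point through a marked point
  ends outside the hull.\<close>

lemma hull_line:
  assumes "q \<in> inner_hull" "b \<in> inner_hull" "q \<in> open_segment a b" "a \<in> points"
  shows "a \<in> inner_hull"
proof -
  have "a \<noteq> b" "q \<noteq> a" "q \<noteq> b"
    using assms(3) by (auto simp: open_segment_def)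
  moreover from this have "collinear {q, b, a}"
    using assms(3) by (subst collinear_iff_open_segments) (auto simp: open_segment_commute)
  ultimately show ?thesis
    using collinearly_closed_c_hull(1)[of marked points] assms
    unfolding collinearly_closed_def by (metis Diff_iff Un_upper2 singletonD)
qed

lemma reversal_outer:
  assumes "x \<in> circle - inner_hull" "i \<in> {1..l}"
  shows "reversal i x \<in> circle - inner_hull"
  using assms reversal_in_circle reversal_between[of x i] marked_subset_hull hull_line[of "p i" "reversal i x" x]
  by blast

text \<open>A point inside a segment is not on the circle, so \<open>q\<close> is marked. Then
  \<open>b\<close> cannot be in the hull, since that would draw \<open>a\<close> in; so
  \<open>b\<close> is on the circle and uniqueness makes it the reversion of
  \<open>a\<close>.\<close>

lemma outer_between_iff:
  assumes a: "a \<in> circle - inner_hull" and b: "b \<in> points" and q: "q \<in> points"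
  shows "q \<in> open_segment a b \<longleftrightarrow> (\<exists>i\<in>{1..l}. q = p i \<and> b = reversal i a)"
proof
  assume *: "q \<in> open_segment a b"
  then have "q \<in> marked"
    using circle_extreme[of a b q] a b q by blast
  then obtain i where i: "i \<in> {1..l}" "q = p i"
    by blast
  have "b \<notin> inner_hull"
    using hull_line[of q b a] \<open>q \<in> marked\<close> * a marked_subset_hull by blast
  then have "b \<in> circle"
    using b marked_subset_hull by blast
  then have "reversal i a = b"
    using reversal_eqI a i * by blast
  then show "\<exists>i\<in>{1..l}. q = p i \<and> b = reversal i a"
    using i by blast
qed (use a reversal_between in auto)

subsection \<open>The action and its orbits\<close>

lemma act_in_circle:
  assumes "x \<in> circle" "set g \<subseteq> {1..l}"
  shows "act_on x g \<in> circle"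
  using assms by (induction g arbitrary: x) (auto simp: act_def reversal_in_circle simp del: mem_sphere)

lemma act_outer:
  assumes "x \<in> circle - inner_hull" "set g \<subseteq> {1..l}"
  shows "act_on x g \<in> circle - inner_hull"
  using assms
proof (induction g arbitrary: x)
  case (Cons i g)
  then show ?case
    using Cons.IH[of "reversal i x"] reversal_outer[of x i] by (simp add: act_def del: mem_sphere)
qed (simp add: act_def)

lemma act_rev:
  assumes "x \<in> circle" "set g \<subseteq> {1..l}"
  shows "act_on (act_on x g) (rev g) = x"
  using assms
proof (induction g arbitrary: x)
  case (Cons i g)
  then show ?case
    using Cons.IH[of "reversal i x"] reversal_in_circle[of x i] reversal_reversal[of x i]
    by (simp add: act_def del: mem_sphere)
qed (simp add: act_def)

text \<open>Each cancelled pair of letters is a reversion applied twice, which is the identity on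
  the circle.\<close>

lemma act_reduce:
  assumes "x \<in> circle" "set g \<subseteq> {1..l}"
  shows "act_on x (reduce g) = act_on x g"
  using assms
proof (induction g arbitrary: x)
  case (Cons i g)
  have i: "reversal i x \<in> circle" "reversal i (reversal i x) = x"
    using Cons.prems reversal_in_circle reversal_reversal by auto
  have "act_on x (reduce_Cons i (reduce g)) = act_on (reversal i x) (reduce g)"
    using i by (cases "reduce g") (auto simp: act_def simp del: mem_sphere)
  then show ?case
    using Cons i by (simp add: act_def del: mem_sphere)
qed simp

lemma reduce_in_carrier:
  assumes "set g \<subseteq> {1..l}"
  shows "reduce g \<in> carrier (seq_group l)"
  using assms set_reduce[of g] distinct_adj_reduce[of g] by (simp add: seq_group_def)

text \<open>Allowing reducible words as well makes plain concatenation available in the orbit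
  arguments below.\<close>

lemma orbit_eq_words:
  assumes "x \<in> circle"
  shows "orbit x = {act_on x g | g. set g \<subseteq> {1..l}}"
proof (intro equalityI subsetI)
  fix y
  assume "y \<in> {act_on x g | g. set g \<subseteq> {1..l}}"
  then obtain g where "set g \<subseteq> {1..l}" "y = act_on x (reduce g)"
    using act_reduce assms by auto
  then show "y \<in> orbit x"
    using reduce_in_carrier by (auto simp: orbit_of_def)
qed (auto simp: orbit_of_def seq_group_def)

lemma orbit_act_eq:
  assumes x: "x \<in> circle" and g: "set g \<subseteq> {1..l}"
  shows "orbit (act_on x g) = orbit x"
proof (intro equalityI subsetI)
  have gx: "act_on x g \<in> circle"
    using act_in_circle x g .
  fix y
  {
    assume "y \<in> orbit (act_on x g)"
    then obtain h where "set h \<subseteq> {1..l}" "y = act_on (act_on x g) h"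
      using orbit_eq_words[OF gx] by blast
    then show "y \<in> orbit x"
      unfolding orbit_eq_words[OF x] mem_Collect_eq using g
      by (intro exI[of _ "g @ h"]) (simp add: act_append)
  next
    assume "y \<in> orbit x"
    then obtain h where "set h \<subseteq> {1..l}" "y = act_on x h"
      using orbit_eq_words[OF x] by blast
    \<comment> \<open>The prefix \<open>rev g\<close> undoes the move by \<open>g\<close>.\<close>
    then show "y \<in> orbit (act_on x g)"
      unfolding orbit_eq_words[OF gx] mem_Collect_eq using x g
      by (intro exI[of _ "rev g @ h"]) (simp add: act_append act_rev)
  }
qed

lemma orbit_eqI:
  assumes "x \<in> circle" "y \<in> orbit x"
  shows "orbit y = orbit x"
  using assms orbit_eq_words orbit_act_eq by auto

lemma self_in_orbit: "x \<in> circle \<Longrightarrow> x \<in> orbit x"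
  unfolding orbit_eq_words by (auto simp: act_def intro!: exI[of _ "[]"])

lemma outer_orbits_eq: "outer_orbits l circle p = orbit ` (circle - inner_hull)"
  unfolding outer_orbits_def by blast

lemma outer_orbits_iff:
  "A \<in> outer_orbits l circle p \<longleftrightarrow> (\<exists>x\<in>circle - inner_hull. A = orbit x)"
  unfolding outer_orbits_eq by blast

lemma outer_orbit_memD:
  assumes A: "A \<in> outer_orbits l circle p" and x: "x \<in> A"
  shows "x \<in> circle - inner_hull" "A = orbit x"
proof -
  obtain a where a: "a \<in> circle - inner_hull" "A = orbit a"
    using A by (auto simp: outer_orbits_iff)
  then show "A = orbit x"
    using x orbit_eqI by auto
  from a x obtain g where "set g \<subseteq> {1..l}" "x = act_on a g"
    using orbit_eq_words by auto
  then show "x \<in> circle - inner_hull"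
    using act_outer[OF a(1)] by blast
qed

text \<open>Here \<open>rev h\<close> is the inverse of \<open>h\<close>. Thus the stabilizer of one
  point decides which words coincide on it, that is, it determines the whole orbit as a set with
  action.\<close>

lemma act_eq_iff_stab:
  assumes x: "x \<in> circle" and g: "set g \<subseteq> {1..l}" and h: "set h \<subseteq> {1..l}"
  shows "act_on x g = act_on x h \<longleftrightarrow> reduce (g @ rev h) \<in> stab x"
proof -
  have "reduce (g @ rev h) \<in> stab x \<longleftrightarrow> act_on (act_on x g) (rev h) = x"
    using x g h reduce_in_carrier[of "g @ rev h"] act_reduce[of x "g @ rev h"]
    by (simp add: stabilizer_of_def act_append)
  also have "\<dots> \<longleftrightarrow> act_on x g = act_on x h"
    using act_rev[OF x h] act_rev[OF act_in_circle[OF x g], of "rev h"] h by auto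
  finally show ?thesis
    by simp
qed

end

section \<open>Two marked circles with equally many points\<close>

locale circles_with_points =
  C: circle_with_points z r l c + D: circle_with_points w s l d
  for z w :: "real^2" and r s :: real and l :: nat and c d :: "nat \<Rightarrow> real^2"
begin

section \<open>From a betweenness isomorphism to the orbit data\<close>

lemma iso_image_marked:
  assumes f: "betweenness_iso f C.points D.points"
  shows "f ` C.marked = D.marked"
proof -
  have fS: "f ` C.points = D.points"
    using f by (auto simp: betweenness_iso_def bij_betw_def)
  have marked_iff: "f x \<in> D.marked \<longleftrightarrow> x \<in> C.marked" if x: "x \<in> C.points" for x
  proof -
    have "f x \<in> D.points"
      using fS x by (metis imageI)
    then have "f x \<in> D.marked \<longleftrightarrow>
        (\<exists>a\<in>f ` C.points. \<exists>b\<in>f ` C.points. f x \<in> open_segment a b)"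
      unfolding fS by (rule D.marked_iff_between)
    also have "\<dots> \<longleftrightarrow> (\<exists>a\<in>C.points. \<exists>b\<in>C.points. x \<in> open_segment a b)"
      using f x by (simp add: betweenness_iso_def)
    also have "\<dots> \<longleftrightarrow> x \<in> C.marked"
      by (rule C.marked_iff_between[OF x, symmetric])
    finally show ?thesis .
  qed
  show ?thesis
  proof (intro equalityI subsetI)
    fix y
    assume "y \<in> f ` C.marked"
    then show "y \<in> D.marked"
      using marked_iff by (metis UnI2 imageE)
  next
    fix y
    assume y: "y \<in> D.marked"
    then have "y \<in> f ` C.points"
      unfolding fS by (rule UnI2)
    then obtain x where "x \<in> C.points" "y = f x"
      by (metis imageE)
    then show "y \<in> f ` C.marked"
      using marked_iff y by (metis imageI)
  qed
qed

lemma iso_permutation: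
  assumes f: "betweenness_iso f C.points D.points"
  obtains \<sigma> where "\<sigma> permutes {1..l}" "\<And>i. i \<in> {1..l} \<Longrightarrow> f (c i) = d (\<sigma> i)"
proof -
  let ?\<tau> = "inv_into {1..l} d \<circ> f \<circ> c"
  \<comment> \<open>Extended by the identity, because \<open>permutes\<close> demands that indices
    outside \<open>{1..l}\<close> stay fixed.\<close>
  let ?\<sigma> = "\<lambda>i. if i \<in> {1..l} then ?\<tau> i else i"
  have img: "f ` C.marked = D.marked"
    by (rule iso_image_marked[OF f])
  have "inj_on f C.marked"
    using f by (auto simp: betweenness_iso_def bij_betw_def intro: inj_on_subset)
  then have "bij_betw f C.marked D.marked"
    using img by (simp add: bij_betw_def)
  moreover have "bij_betw c {1..l} C.marked" "bij_betw d {1..l} D.marked"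
    using C.inj_p D.inj_p by (auto simp: bij_betw_def)
  ultimately have "bij_betw ?\<tau> {1..l} {1..l}"
    by (metis bij_betw_inv_into bij_betw_trans)
  then have "bij_betw ?\<sigma> {1..l} {1..l}"
    by (rule iffD1[OF bij_betw_cong, rotated]) simp
  then have "?\<sigma> permutes {1..l}"
    by (rule bij_imp_permutes) (simp only: if_False)
  moreover have "f (c i) = d (?\<sigma> i)" if "i \<in> {1..l}" for i
  proof -
    have "f (c i) \<in> D.marked"
      using that img by blast
    then show ?thesis
      using that by (simp add: f_inv_into_f del: One_nat_def)
  qed
  ultimately show ?thesis
    using that by blast
qed

text \<open>Induction on the word. For one letter, \<open>f\<close> sends \<open>c i\<close> to
  \<open>d (\<sigma> i)\<close>, which then lies between the images of \<open>x\<close> and its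
  reversion; uniqueness of the second circle point finishes.\<close>

lemma iso_act:
  assumes f: "betweenness_iso f C.points D.points"
    and \<sigma>: "\<sigma> permutes {1..l}" and fc: "\<And>i. i \<in> {1..l} \<Longrightarrow> f (c i) = d (\<sigma> i)"
    and x: "x \<in> C.circle" and g: "set g \<subseteq> {1..l}"
  shows "f (C.act_on x g) = D.act_on (f x) (map \<sigma> g)"
  using x g
proof (induction g arbitrary: x)
  case (Cons i g)
  \<comment> \<open>Marked points of \<open>D\<close> are already images of marked points, so
    injectivity keeps circle points on the circle.\<close>
  have circle: "f y \<in> D.circle" if y: "y \<in> C.circle" for y
  proof -
    have "inj_on f C.points" "f y \<in> D.points"
      using f y by (auto simp: betweenness_iso_def bij_betw_def)
    moreover have "y \<notin> C.marked"
      using y C.marked_notin_circle by blast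
    ultimately have "f y \<notin> f ` C.marked"
      using y by (simp add: inj_on_image_mem_iff)
    then show ?thesis
      using \<open>f y \<in> D.points\<close> iso_image_marked[OF f] by blast
  qed
  have i: "i \<in> {1..l}"
    using Cons.prems by simp
  have rx: "C.reversal i x \<in> C.circle" "c i \<in> open_segment x (C.reversal i x)"
    using C.reversal_in_circle C.reversal_between Cons.prems(1) i by blast+
  then have "f (c i) \<in> open_segment (f x) (f (C.reversal i x))"
    using f Cons.prems(1) i unfolding betweenness_iso_def by blast
  then have "D.reversal (\<sigma> i) (f x) = f (C.reversal i x)"
    using rx Cons.prems(1) i fc circle permutes_in_image[OF \<sigma>, of i]
    by (intro D.reversal_eqI) (auto simp del: mem_sphere)
  then show ?case
    using Cons.IH[of "C.reversal i x"] Cons.prems(2) rx by (simp add: act_def del: mem_sphere)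
qed (simp add: act_def)

text \<open>Stabilizers contain irreducible words only, so besides \<open>eq\<close> the relabelling
  must preserve and reflect irreducibility and reach every word.\<close>

lemma psi_image_stabilizer:
  assumes \<sigma>: "\<sigma> permutes {1..l}"
    and eq: "\<And>g. set g \<subseteq> {1..l} \<Longrightarrow> D.act_on y (map \<sigma> g) = y \<longleftrightarrow> C.act_on x g = x"
  shows "D.stab y = psi \<sigma> ` C.stab x"
proof (intro equalityI subsetI)
  have inj: "inj \<sigma>"
    using \<sigma> permutes_inj by blast
  have adj: "distinct_adj (map \<sigma> g) \<longleftrightarrow> distinct_adj g" for g
    using inj by (simp add: distinct_adj_map_iff inj_on_subset)
  fix k
  {
    assume k: "k \<in> D.stab y"
    then have "set k \<subseteq> {1..l}"
      by (simp add: stabilizer_of_def seq_group_def)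
    then obtain g where kg: "k = map \<sigma> g" and "set g \<subseteq> {1..l}"
      using permutes_word_preimage[OF \<sigma>] by blast
    then have "g \<in> C.stab x"
      using k kg adj eq by (auto simp: stabilizer_of_def seq_group_def)
    then show "k \<in> psi \<sigma> ` C.stab x"
      using kg by (auto simp: psi_def)
  next
    assume "k \<in> psi \<sigma> ` C.stab x"
    then obtain g where g: "g \<in> C.stab x" "k = map \<sigma> g"
      by (auto simp: psi_def)
    then have "set g \<subseteq> {1..l}"
      by (simp add: stabilizer_of_def seq_group_def)
    then show "k \<in> D.stab y"
      using g adj eq permutes_in_image[OF \<sigma>]
      by (auto simp: stabilizer_of_def seq_group_def simp del: atLeastAtMost_iff)
  }
qed

lemma iso_imp_orbit_data:
  assumes f: "betweenness_iso f C.points D.points"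
  shows "\<exists>f \<sigma>. betweenness_iso f C.inner_hull D.inner_hull \<and>
    \<sigma> permutes {1..l} \<and> (\<forall>i\<in>{1..l}. f (c i) = d (\<sigma> i)) \<and>
    (\<exists>h. bij_betw h (outer_orbits l C.circle c) (outer_orbits l D.circle d) \<and>
      (\<forall>A\<in>outer_orbits l C.circle c. \<exists>x\<in>A. \<exists>y\<in>h A. D.stab y = psi \<sigma> ` C.stab x))"
proof -
  obtain \<sigma> where \<sigma>: "\<sigma> permutes {1..l}" and fc: "\<And>i. i \<in> {1..l} \<Longrightarrow> f (c i) = d (\<sigma> i)"
    using iso_permutation[OF f] by blast
  have inj: "inj_on f C.points" and fS: "f ` C.points = D.points"
    using f by (auto simp: betweenness_iso_def bij_betw_def)
  have hull: "f ` C.inner_hull = D.inner_hull"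
    using c_hull_image[OF f, of C.marked] iso_image_marked[OF f] by simp
  then have "betweenness_iso f C.inner_hull D.inner_hull"
    using f C.hull_subset_points inj unfolding betweenness_iso_def bij_betw_def
    by (meson inj_on_subset subsetD)
  moreover
  have outer: "f ` (C.circle - C.inner_hull) = D.circle - D.inner_hull"
    using inj_on_image_set_diff[OF inj, of C.points C.inner_hull] C.hull_subset_points fS hull
      C.points_diff_hull D.points_diff_hull by auto
  \<comment> \<open>Equivariance gives one inclusion; for the other, every word acting on
    \<open>D\<close> is a relabelled word acting on \<open>C\<close>.\<close>
  have orbit: "f ` C.orbit x = D.orbit (f x)" if x: "x \<in> C.circle - C.inner_hull" for x
  proof (intro equalityI subsetI)
    have fx: "f x \<in> D.circle"
      using outer x by blast
    have fact: "f (C.act_on x g) = D.act_on (f x) (map \<sigma> g)" if "set g \<subseteq> {1..l}" for g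
      using iso_act[OF f \<sigma> fc _ that] x by blast
    fix y
    {
      assume "y \<in> f ` C.orbit x"
      then obtain g where g: "set g \<subseteq> {1..l}" "y = D.act_on (f x) (map \<sigma> g)"
        using C.orbit_eq_words[of x] fact x by auto
      then have "set (map \<sigma> g) \<subseteq> {1..l}"
        using permutes_image[OF \<sigma>] by auto
      then show "y \<in> D.orbit (f x)"
        using g unfolding D.orbit_eq_words[OF fx] by blast
    next
      assume "y \<in> D.orbit (f x)"
      then obtain k where k: "set k \<subseteq> {1..l}" "y = D.act_on (f x) k"
        unfolding D.orbit_eq_words[OF fx] by blast
      obtain g where "k = map \<sigma> g" "set g \<subseteq> {1..l}"
        using permutes_word_preimage[OF \<sigma> k(1)] by blast
      then have "y = f (C.act_on x g)" "C.act_on x g \<in> C.orbit x"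
        using k fact[of g] C.orbit_eq_words[of x] x by auto
      then show "y \<in> f ` C.orbit x"
        by blast
    }
  qed
  \<comment> \<open>The bijection \<open>h\<close> between orbits sends each orbit to its image
    under \<open>f\<close>.\<close>
  have "bij_betw ((`) f) (outer_orbits l C.circle c) (outer_orbits l D.circle d)"
  proof (rule bij_betw_imageI)
    have "A \<subseteq> C.points" if "A \<in> outer_orbits l C.circle c" for A
      using C.outer_orbit_memD(1)[OF that] by blast
    then show "inj_on ((`) f) (outer_orbits l C.circle c)"
      using inj by (auto simp: inj_on_def inj_on_image_eq_iff)
    have "(`) f ` outer_orbits l C.circle c = (\<lambda>x. f ` C.orbit x) ` (C.circle - C.inner_hull)"
      by (simp only: C.outer_orbits_eq image_image)
    also have "\<dots> = (\<lambda>x. D.orbit (f x)) ` (C.circle - C.inner_hull)"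
      using orbit by (rule image_cong[OF HOL.refl])
    also have "\<dots> = D.orbit ` (D.circle - D.inner_hull)"
      by (simp only: outer[symmetric] image_image)
    also have "\<dots> = outer_orbits l D.circle d"
      by (rule D.outer_orbits_eq[symmetric])
    finally show "(`) f ` outer_orbits l C.circle c = outer_orbits l D.circle d" .
  qed
  moreover have "\<exists>x\<in>A. \<exists>y\<in>f ` A. D.stab y = psi \<sigma> ` C.stab x"
    if A: "A \<in> outer_orbits l C.circle c" for A
  proof -
    obtain x where x: "x \<in> C.circle - C.inner_hull" "A = C.orbit x"
      using A by (auto simp: C.outer_orbits_iff)
    \<comment> \<open>Any representative \<open>x\<close> of the orbit works, paired with
      \<open>f x\<close>.\<close>
    have "D.stab (f x) = psi \<sigma> ` C.stab x"
    proof (rule psi_image_stabilizer[OF \<sigma>])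
      fix g
      assume g: "set g \<subseteq> {1..l}"
      have "D.act_on (f x) (map \<sigma> g) = f (C.act_on x g)"
        using iso_act[OF f \<sigma> fc _ g] x by simp
      moreover have "C.act_on x g \<in> C.points" "x \<in> C.points"
        using C.act_in_circle[OF _ g] x by blast+
      ultimately show "D.act_on (f x) (map \<sigma> g) = f x \<longleftrightarrow> C.act_on x g = x"
        using inj by (simp add: inj_on_eq_iff)
    qed
    then show ?thesis
      using x C.self_in_orbit by blast
  qed
  ultimately show ?thesis
    using \<sigma> fc by blast
qed

section \<open>From the orbit data to a betweenness isomorphism\<close>

text \<open>Coincidences of words on both sides are stabilizer memberships, which \<open>st\<close>
  matches. From right to left this yields well-definedness of the orbit map, from left to right its
  injectivity.\<close>

lemma act_eq_transfer:
  assumes \<sigma>: "\<sigma> permutes {1..l}" and x: "x \<in> C.circle" and y: "y \<in> D.circle"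
    and st: "D.stab y = psi \<sigma> ` C.stab x"
    and g: "set g \<subseteq> {1..l}" and h: "set h \<subseteq> {1..l}"
  shows "D.act_on y (map \<sigma> g) = D.act_on y (map \<sigma> h) \<longleftrightarrow> C.act_on x g = C.act_on x h"
proof -
  have inj: "inj \<sigma>"
    using \<sigma> permutes_inj by blast
  have word: "set (map \<sigma> k) \<subseteq> {1..l}" if "set k \<subseteq> {1..l}" for k
    using that permutes_image[OF \<sigma>] by auto
  have "D.act_on y (map \<sigma> g) = D.act_on y (map \<sigma> h) \<longleftrightarrow>
      reduce (map \<sigma> (g @ rev h)) \<in> D.stab y"
    using D.act_eq_iff_stab[OF y word[OF g] word[OF h]] by (simp add: rev_map)
  also have "\<dots> \<longleftrightarrow> map \<sigma> (reduce (g @ rev h)) \<in> map \<sigma> ` C.stab x"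
    by (simp only: reduce_map[OF inj] st psi_def[abs_def])
  also have "\<dots> \<longleftrightarrow> reduce (g @ rev h) \<in> C.stab x"
    by (rule inj_image_mem_iff) (use inj in simp)
  also have "\<dots> \<longleftrightarrow> C.act_on x g = C.act_on x h"
    using C.act_eq_iff_stab[OF x g h] by simp
  finally show ?thesis .
qed

lemma outer_equivariant_bij:
  assumes \<sigma>: "\<sigma> permutes {1..l}"
    and h: "bij_betw h (outer_orbits l C.circle c) (outer_orbits l D.circle d)"
    and st: "\<forall>A\<in>outer_orbits l C.circle c. \<exists>x\<in>A. \<exists>y\<in>h A. D.stab y = psi \<sigma> ` C.stab x"
  obtains F where "bij_betw F (C.circle - C.inner_hull) (D.circle - D.inner_hull)"
    "\<And>x i. x \<in> C.circle - C.inner_hull \<Longrightarrow> i \<in> {1..l} \<Longrightarrow>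
      F (C.reversal i x) = D.reversal (\<sigma> i) (F x)"
proof -
  let ?OC = "outer_orbits l C.circle c" and ?OD = "outer_orbits l D.circle d"
  obtain X Y where XY: "\<And>A. A \<in> ?OC \<Longrightarrow> X A \<in> A \<and> Y A \<in> h A \<and>
      D.stab (Y A) = psi \<sigma> ` C.stab (X A)"
    using st by metis
  have hA: "h A \<in> ?OD" if "A \<in> ?OC" for A
    using h that by (auto simp: bij_betw_def)
  have X: "X A \<in> C.circle - C.inner_hull" "A = C.orbit (X A)" if "A \<in> ?OC" for A
    using C.outer_orbit_memD[OF that] XY[OF that] by auto
  have Y: "Y A \<in> D.circle - D.inner_hull" "h A = D.orbit (Y A)" if "A \<in> ?OC" for A
    using D.outer_orbit_memD[OF hA[OF that]] XY[OF that] by auto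
  have word: "set (map \<sigma> k) \<subseteq> {1..l}" if "set k \<subseteq> {1..l}" for k
    using that permutes_image[OF \<sigma>] by auto
  have transfer: "D.act_on (Y A) (map \<sigma> g) = D.act_on (Y A) (map \<sigma> k) \<longleftrightarrow>
      C.act_on (X A) g = C.act_on (X A) k"
    if "A \<in> ?OC" "set g \<subseteq> {1..l}" "set k \<subseteq> {1..l}" for A g k
    using act_eq_transfer[OF \<sigma>, of "X A" "Y A"] X[OF that(1)] Y[OF that(1)] XY[OF that(1)] that
    by blast
  \<comment> \<open>An arbitrary word leading from the base point of the orbit to \<open>x\<close>;
    it may be reducible and is far from unique.\<close>
  define G where "G x = (SOME g. set g \<subseteq> {1..l} \<and> C.act_on (X (C.orbit x)) g = x)" for x
  define F where "F x = D.act_on (Y (C.orbit x)) (map \<sigma> (G x))" for x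
  have orbit: "C.orbit x \<in> ?OC" if "x \<in> C.circle - C.inner_hull" for x
    using that by (auto simp: C.outer_orbits_iff)
  have G: "set (G x) \<subseteq> {1..l}" "C.act_on (X (C.orbit x)) (G x) = x"
    if x: "x \<in> C.circle - C.inner_hull" for x
  proof -
    have "x \<in> C.orbit (X (C.orbit x))"
      using C.self_in_orbit[of x] X(2)[OF orbit[OF x]] x by auto
    then have "\<exists>g. set g \<subseteq> {1..l} \<and> C.act_on (X (C.orbit x)) g = x"
      using C.orbit_eq_words[of "X (C.orbit x)"] X(1)[OF orbit[OF x]] by auto
    from someI_ex[OF this] show "set (G x) \<subseteq> {1..l}" "C.act_on (X (C.orbit x)) (G x) = x"
      unfolding G_def by auto
  qed
  \<comment> \<open>Independence of the choice: \<open>g\<close> and the word picked by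
    \<open>G\<close> reach the same point from \<open>X A\<close>, so \<open>transfer\<close> makes
    their images agree.\<close>
  have F: "F (C.act_on (X A) g) = D.act_on (Y A) (map \<sigma> g)"
    if A: "A \<in> ?OC" and g: "set g \<subseteq> {1..l}" for A g
  proof -
    let ?x = "C.act_on (X A) g"
    have x: "?x \<in> C.circle - C.inner_hull"
      using C.act_outer X[OF A] g by blast
    have "C.orbit ?x = A"
      using C.orbit_act_eq[OF _ g] X[OF A] by auto
    then show ?thesis
      using transfer[OF A G(1)[OF x] g] G(2)[OF x] by (simp add: F_def)
  qed
  have F_orbit: "F x \<in> h (C.orbit x)" if x: "x \<in> C.circle - C.inner_hull" for x
    using D.orbit_eq_words[of "Y (C.orbit x)"] Y[OF orbit[OF x]] word[OF G(1)[OF x]]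
    unfolding F_def by blast
  have "bij_betw F (C.circle - C.inner_hull) (D.circle - D.inner_hull)"
  proof (intro bij_betw_imageI inj_onI equalityI subsetI)
    fix x x'
    assume x: "x \<in> C.circle - C.inner_hull" and x': "x' \<in> C.circle - C.inner_hull"
      and eq: "F x = F x'"
    \<comment> \<open>Equal values lie in one orbit on the \<open>D\<close> side. Injectivity of
      \<open>h\<close> then puts \<open>x\<close> and \<open>x'\<close> into one orbit, where
      \<open>transfer\<close> separates points.\<close>
    have "h (C.orbit x) = h (C.orbit x')"
      using D.outer_orbit_memD(2)[OF hA[OF orbit] F_orbit] x x' eq by metis
    then have oeq: "C.orbit x = C.orbit x'"
      using h orbit[OF x] orbit[OF x'] by (auto simp: bij_betw_def dest: inj_onD)
    then show "x = x'"
      using transfer[OF orbit[OF x] G(1)[OF x] G(1)[OF x']] G(2)[OF x] G(2)[OF x'] eq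
      by (simp add: F_def)
  next
    fix y
    assume "y \<in> F ` (C.circle - C.inner_hull)"
    then show "y \<in> D.circle - D.inner_hull"
      using D.outer_orbit_memD(1)[OF hA[OF orbit] F_orbit] by blast
  next
    fix y
    assume y: "y \<in> D.circle - D.inner_hull"
    then have "D.orbit y \<in> h ` ?OC"
      using bij_betw_imp_surj_on[OF h] by (auto simp: D.outer_orbits_iff)
    then obtain A where A: "A \<in> ?OC" "h A = D.orbit y"
      by (metis imageE)
    have "y \<in> D.orbit (Y A)"
      using Y(2)[OF A(1)] A(2) D.self_in_orbit[of y] y by auto
    then obtain k where k: "set k \<subseteq> {1..l}" "y = D.act_on (Y A) k"
      using D.orbit_eq_words[of "Y A"] Y(1)[OF A(1)] by auto
    obtain g where g: "k = map \<sigma> g" "set g \<subseteq> {1..l}"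
      using permutes_word_preimage[OF \<sigma> k(1)] by blast
    then have "y = F (C.act_on (X A) g)"
      using F[OF A(1)] k by simp
    then show "y \<in> F ` (C.circle - C.inner_hull)"
      using C.act_outer[OF X(1)[OF A(1)] g(2)] by blast
  qed
  moreover have "F (C.reversal i x) = D.reversal (\<sigma> i) (F x)"
    if x: "x \<in> C.circle - C.inner_hull" and i: "i \<in> {1..l}" for x i
  proof -
    let ?A = "C.orbit x" and ?g = "G x"
    \<comment> \<open>Appending \<open>i\<close> to a word for \<open>x\<close> gives a word for its
      reversion, and the fact \<open>F\<close> accepts any such word.\<close>
    have "C.reversal i x = C.act_on (X ?A) (?g @ [i])"
      using G(2)[OF x] by (simp add: act_def)
    then have "F (C.reversal i x) = D.act_on (Y ?A) (map \<sigma> (?g @ [i]))"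
      using F[OF orbit[OF x], of "?g @ [i]"] G(1)[OF x] i by simp
    then show ?thesis
      by (simp add: F_def act_def)
  qed
  ultimately show ?thesis
    by (rule that)
qed

lemma orbit_data_imp_iso:
  assumes f: "betweenness_iso f C.inner_hull D.inner_hull"
    and \<sigma>: "\<sigma> permutes {1..l}" and fc: "\<forall>i\<in>{1..l}. f (c i) = d (\<sigma> i)"
    and h: "bij_betw h (outer_orbits l C.circle c) (outer_orbits l D.circle d)"
    and st: "\<forall>A\<in>outer_orbits l C.circle c. \<exists>x\<in>A. \<exists>y\<in>h A. D.stab y = psi \<sigma> ` C.stab x"
  shows "betweenness_isomorphic C.points D.points"
proof -
  obtain F where F: "bij_betw F (C.circle - C.inner_hull) (D.circle - D.inner_hull)"
    and F_reversal: "\<And>x i. x \<in> C.circle - C.inner_hull \<Longrightarrow> i \<in> {1..l} \<Longrightarrow>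
      F (C.reversal i x) = D.reversal (\<sigma> i) (F x)"
    using outer_equivariant_bij[OF \<sigma> h st] by blast
  \<comment> \<open>Hull and outer circle points partition the point set on either side, so gluing
    the two bijections gives a bijection.\<close>
  define k where "k x = (if x \<in> C.inner_hull then f x else F x)" for x
  have k_hull: "k x = f x" if "x \<in> C.inner_hull" for x
    using that by (simp add: k_def)
  have k_outer: "k x = F x" if "x \<in> C.circle - C.inner_hull" for x
    using that by (simp add: k_def)
  have kf: "bij_betw k C.inner_hull D.inner_hull"
    using f unfolding betweenness_iso_def by (simp only: k_hull cong: bij_betw_cong)
  have kF: "bij_betw k (C.circle - C.inner_hull) (D.circle - D.inner_hull)"
    using F by (simp only: k_outer cong: bij_betw_cong)
  have S: "C.inner_hull \<union> (C.circle - C.inner_hull) = C.points"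
    "D.inner_hull \<union> (D.circle - D.inner_hull) = D.points"
    using C.points_diff_hull D.points_diff_hull C.hull_subset_points D.hull_subset_points by blast+
  have bij: "bij_betw k C.points D.points"
    using bij_betw_combine[OF kf kF] unfolding S by blast
  have in_R: "k x \<in> D.points" if "x \<in> C.points" for x
    using bij that by (auto simp: bij_betw_def)
  have k_eq: "k x = k y \<longleftrightarrow> x = y" if "x \<in> C.points" "y \<in> C.points" for x y
    using bij_betw_imp_inj_on[OF bij] that by (rule inj_on_eq_iff)
  have kc: "k (c i) = d (\<sigma> i)" if "i \<in> {1..l}" for i
  proof -
    have "c i \<in> C.inner_hull"
      using that C.marked_subset_hull by blast
    then show ?thesis
      using that fc by (simp only: k_hull)
  qed
  have outer: "q \<in> open_segment a b \<longleftrightarrow> k q \<in> open_segment (k a) (k b)"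
    if a: "a \<in> C.circle - C.inner_hull" and b: "b \<in> C.points" and q: "q \<in> C.points" for a b q
  proof -
    have ka: "k a \<in> D.circle - D.inner_hull"
      by (rule bij_betw_apply[OF kF a])
    have reversal: "C.reversal i a \<in> C.points" "k (C.reversal i a) = D.reversal (\<sigma> i) (k a)"
      if "i \<in> {1..l}" for i
    proof -
      have "C.reversal i a \<in> C.circle - C.inner_hull"
        by (rule C.reversal_outer[OF a that])
      then show "C.reversal i a \<in> C.points" "k (C.reversal i a) = D.reversal (\<sigma> i) (k a)"
        by (blast, simp only: k_outer a F_reversal[OF a that])
    qed
    have "q \<in> open_segment a b \<longleftrightarrow> (\<exists>i\<in>{1..l}. q = c i \<and> b = C.reversal i a)"
      by (rule C.outer_between_iff[OF a b q])
    also have "\<dots> \<longleftrightarrow> (\<exists>i\<in>{1..l}. k q = k (c i) \<and> k b = k (C.reversal i a))"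
      by (intro bex_cong HOL.refl) (simp only: k_eq q b reversal(1) UnI2 imageI)
    also have "\<dots> \<longleftrightarrow> (\<exists>i\<in>{1..l}. k q = d (\<sigma> i) \<and> k b = D.reversal (\<sigma> i) (k a))"
      by (simp only: kc reversal(2) cong: bex_cong)
    \<comment> \<open>Reindexing along \<open>\<sigma>\<close>, which maps \<open>{1..l}\<close>
      onto itself, produces the criterion \<open>outer_between_iff\<close> for
      \<open>D\<close>.\<close>
    also have "\<dots> \<longleftrightarrow> (\<exists>j\<in>\<sigma> ` {1..l}. k q = d j \<and> k b = D.reversal j (k a))"
      by blast
    also have "\<dots> \<longleftrightarrow> k q \<in> open_segment (k a) (k b)"
      unfolding permutes_image[OF \<sigma>]
      using D.outer_between_iff[OF ka in_R[OF b] in_R[OF q]] by blast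
    finally show ?thesis .
  qed
  \<comment> \<open>For \<open>q\<close> in the hull this is the hypothesis on \<open>f\<close>.
    Otherwise \<open>q\<close> and \<open>k q\<close> lie on the circles and are between no two
    points, so both sides fail.\<close>
  have inner: "q \<in> open_segment a b \<longleftrightarrow> k q \<in> open_segment (k a) (k b)"
    if a: "a \<in> C.inner_hull" and b: "b \<in> C.inner_hull" and q: "q \<in> C.points" for a b q
  proof (cases "q \<in> C.inner_hull")
    case True
    then show ?thesis
      using f a b by (simp add: betweenness_iso_def k_hull)
  next
    case False
    then have q_circle: "q \<in> C.circle - C.inner_hull"
      using q C.marked_subset_hull by blast
    then have "k q \<in> D.circle"
      using bij_betw_apply[OF kF] by blast
    then show ?thesis
      using C.circle_extreme[of a b q] D.circle_extreme[of "k a" "k b" "k q"] q_circle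
        in_R[of a] in_R[of b] a b C.hull_subset_points by blast
  qed
  \<comment> \<open>If either endpoint is outer, \<open>outer\<close> applies after possibly
    swapping \<open>a\<close> and \<open>b\<close>; else both are in the hull.\<close>
  have "q \<in> open_segment a b \<longleftrightarrow> k q \<in> open_segment (k a) (k b)"
    if "a \<in> C.points" "b \<in> C.points" "q \<in> C.points" for a b q
    using outer[of a b q] outer[of b a q] inner[of a b q] that C.points_diff_hull
    by (metis Diff_iff open_segment_commute)
  then have "betweenness_iso k C.points D.points"
    using bij unfolding betweenness_iso_def by blast
  then show ?thesis
    unfolding betweenness_isomorphic_def by blast
qed

end

theorem corollary3p5:
  fixes l :: nat and z w :: "real^2" and r s :: real
    and c d :: "nat \<Rightarrow> real^2" and C D S R :: "(real^2) set"
  assumes "r > 0" and "C = sphere z r"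
    and "s > 0" and "D = sphere w s"
    and "inj_on c {1..l}" and "\<forall>i\<in>{1..l}. c i \<in> ball z r"
    and "inj_on d {1..l}" and "\<forall>i\<in>{1..l}. d i \<in> ball w s"
    and "S = C \<union> c ` {1..l}" and "R = D \<union> d ` {1..l}"
  shows "betweenness_isomorphic S R \<longleftrightarrow>
    (\<exists>f \<sigma>. betweenness_iso f (c_hull S (c ` {1..l})) (c_hull R (d ` {1..l})) \<and>
       \<sigma> permutes {1..l} \<and> (\<forall>i\<in>{1..l}. f (c i) = d (\<sigma> i)) \<and>
       (\<exists>h. bij_betw h (outer_orbits l C c) (outer_orbits l D d) \<and>
          (\<forall>A\<in>outer_orbits l C c. \<exists>x\<in>A. \<exists>y\<in>h A.
             stabilizer_of l D d y = psi \<sigma> ` stabilizer_of l C c x)))"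
proof -
  interpret circles_with_points z w r s l c d
    by unfold_locales (use assms in auto)
  show ?thesis
    unfolding assms(2,4,9,10)
  proof
    assume "betweenness_isomorphic C.points D.points"
    then show "\<exists>f \<sigma>. betweenness_iso f C.inner_hull D.inner_hull \<and>
       \<sigma> permutes {1..l} \<and> (\<forall>i\<in>{1..l}. f (c i) = d (\<sigma> i)) \<and>
       (\<exists>h. bij_betw h (outer_orbits l C.circle c) (outer_orbits l D.circle d) \<and>
          (\<forall>A\<in>outer_orbits l C.circle c. \<exists>x\<in>A. \<exists>y\<in>h A. D.stab y = psi \<sigma> ` C.stab x))"
      unfolding betweenness_isomorphic_def using iso_imp_orbit_data by blast
  qed (use orbit_data_imp_iso in blast)
qed

end
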